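(* For all integers $m, n\geq 0$, we have $$(q;q)_m(q;q)_n=\sum_{k=-n-1}^{m}(-1)^k\, k\, q^{\binom{k+1}{2}} {m+n+1 \brack n+k+1}.$$
   Context: The $q$-shifted factorial is defined by $(x;q)_0=1$ and $(x;q)_n=(1-x)(1-qx)\cdots(1-q^{n-1}x)$ for $n\ge 1$; in particular $(q;q)_n=\prod_{i=1}^n(1-q^i)$. The $q$-binomial (Gauss) coefficient is ${n\brack k}=\frac{(q;q)_n}{(q;q)_k(q;q)_{n-k}}$ for $0\le k\le n$, which is a polynomial in $q$. For every integer $k$ (possibly negative), $\binom{k+1}{2}=\frac{k(k+1)}{2}$, a nonnegative integer. The identity is an identity of polynomials in the indeterminate $q$. *)

theory Defs
  imports "HOL-Computational_Algebra.Polynomial"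
begin

definition q_shifted_fact :: "'a::comm_ring_1 \<Rightarrow> 'a \<Rightarrow> nat \<Rightarrow> 'a" where
  "q_shifted_fact x q n = (\<Prod>i<n. 1 - q ^ i * x)"

abbreviation qvar :: "int poly" where
  "qvar \<equiv> [:0, 1:]"

(* The div below is the division of the integral domain int poly; it is meaningful because
   it is exact, see q_shifted_fact_dvd and q_binomial_mult. *)
definition q_binomial :: "nat \<Rightarrow> nat \<Rightarrow> int poly" where
  "q_binomial n k =
     (if k \<le> n
      then q_shifted_fact qvar qvar n
             div (q_shifted_fact qvar qvar k * q_shifted_fact qvar qvar (n - k))
      else 0)"

lemma q_shifted_fact_0: "q_shifted_fact x q 0 = 1"
  by (simp add: q_shifted_fact_def)

lemma q_shifted_fact_self_Suc:
  "q_shifted_fact q q (Suc n) = q_shifted_fact q q n * (1 - q ^ Suc n)"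
  by (simp add: q_shifted_fact_def mult.commute)

lemma q_shifted_fact_self: "q_shifted_fact q q n = (\<Prod>i=1..n. 1 - q ^ i)"
  by (induction n) (simp_all add: q_shifted_fact_0 q_shifted_fact_self_Suc)

lemma q_shifted_fact_dvd:
  "q_shifted_fact q q a * q_shifted_fact q q b dvd q_shifted_fact q q (a + b)"
proof (induction "a + b" arbitrary: a b)
  case 0
  then show ?case by (simp add: q_shifted_fact_0)
next
  case (Suc s)
  show ?case
  proof (cases "a = 0 \<or> b = 0")
    case True
    then show ?thesis by (auto simp: q_shifted_fact_0)
  next
    case False
    then obtain c d where ab: "a = Suc c" "b = Suc d"
      by (meson not0_implies_Suc)
    have s: "s = c + b" "s = a + d"
      using Suc.hyps(2) ab by auto
    let ?F = "q_shifted_fact q q"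
    have "?F c * ?F b * (1 - q ^ a) dvd ?F s * (1 - q ^ a)"
      using Suc.hyps(1)[OF s(1)] s(1) by (simp add: mult_dvd_mono)
    then have 1: "?F a * ?F b dvd ?F s * (1 - q ^ a)"
      by (simp only: ab(1) q_shifted_fact_self_Suc mult_ac)
    have "?F a * ?F d * (1 - q ^ b) dvd ?F s * (1 - q ^ b)"
      using Suc.hyps(1)[OF s(2)] s(2) by (simp add: mult_dvd_mono)
    then have 2: "?F a * ?F b dvd ?F s * (1 - q ^ b)"
      by (simp only: ab(2) q_shifted_fact_self_Suc mult_ac)
    have "?F (a + b) = ?F s * (1 - q ^ (a + b))"
      using Suc.hyps(2) q_shifted_fact_self_Suc[of q s] by simp
    also have "\<dots> = ?F s * (1 - q ^ a) + q ^ a * (?F s * (1 - q ^ b))"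
      by (simp add: algebra_simps power_add)
    finally show ?thesis
      using 1 2 by simp
  qed
qed

lemma q_binomial_mult:
  assumes "k \<le> n"
  shows "q_binomial n k * (q_shifted_fact qvar qvar k * q_shifted_fact qvar qvar (n - k))
           = q_shifted_fact qvar qvar n"
  using q_shifted_fact_dvd[of qvar k "n - k"] assms by (simp add: q_binomial_def)

lemma q_shifted_fact_qvar_nonzero: "q_shifted_fact qvar qvar n \<noteq> 0"
proof -
  have "poly (1 - qvar ^ Suc i) 0 = 1" for i
    by simp
  then have "1 - qvar ^ Suc i \<noteq> 0" for i
    by (metis poly_0 zero_neq_one)
  then show ?thesis
    by (induction n) (simp_all add: q_shifted_fact_0 q_shifted_fact_self_Suc del: power_Suc)
qed

end

theory Submission
  imports Defs
begin

text \<open>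
  The identity is the derivative at \<open>z = 1\<close> of a finite form of the Jacobi triple product,
  \[
    \sum_{k=-n-1}^{m} (-1)^k q^{k(k+1)/2} {m+n+1 \brack n+k+1} z^{n+k+1}
      = (z - 1) \prod_{i=1}^{m} (1 - q^i z) \prod_{i=1}^{n} (z - q^i).
  \]
  The power of \<open>z\<close> is shifted by \<open>n + 1\<close>, so that both sides are polynomials in \<open>z\<close> with coefficients
  in \<open>\<int>[q]\<close>. Each of the two \<open>q\<close>-Pascal rules turns the left-hand side for \<open>(m, n)\<close> into the one for
  \<open>(m + 1, n)\<close> or \<open>(m, n + 1)\<close>, at the price of one new linear factor; this proves the formula by
  induction (\<open>coeff_triple_product\<close>).

  Because of the factor \<open>z - 1\<close>, the right-hand side vanishes at \<open>z = 1\<close>, and its derivative there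
  is the value of the remaining factors, \<open>(q;q)\<^sub>m (q;q)\<^sub>n\<close>. On the left the derivative at \<open>1\<close> weights
  the \<open>k\<close>-th term by \<open>n + k + 1\<close>; since the unweighted sum is zero, the weight can be replaced by \<open>k\<close>.
\<close>

section \<open>The q-Pascal rules\<close>

text \<open>Both \<open>q\<close>-Pascal rules come from comparing the numerators of the three \<open>q\<close>-binomials over the
  common denominator \<open>(q;q)\<^bsub>k+1\<^esub> (q;q)\<^bsub>n-k\<^esub>\<close>. These are the two smaller numerators; at \<open>k = n\<close> the
  factor \<open>1 - q\<^bsup>n-k\<^esup>\<close> vanishes, in accordance with the convention for \<open>q_binomial n (Suc n)\<close>.\<close>

lemma q_binomial_common_denominator:
  assumes "k \<le> n"
  shows "q_binomial n (Suc k) *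
           (q_shifted_fact qvar qvar (Suc k) * q_shifted_fact qvar qvar (n - k))
           = q_shifted_fact qvar qvar n * (1 - qvar ^ (n - k))" (is ?upper)
    and "q_binomial n k *
           (q_shifted_fact qvar qvar (Suc k) * q_shifted_fact qvar qvar (n - k))
           = q_shifted_fact qvar qvar n * (1 - qvar ^ Suc k)" (is ?lower)
proof -
  show ?upper
  proof (cases "k = n")
    case True
    then show ?thesis by (simp add: q_binomial_def)
  next
    case False
    then have less: "Suc k \<le> n" and diff: "n - k = Suc (n - Suc k)"
      using assms by auto
    show ?thesis
      unfolding q_binomial_mult[OF less, symmetric] diff
      by (simp only: q_shifted_fact_self_Suc[of _ "n - Suc k"] mult_ac)
  qed
  show ?lower
    unfolding q_binomial_mult[OF assms, symmetric]
    by (simp only: q_shifted_fact_self_Suc mult_ac)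
qed

lemma q_pascal:
  assumes "k \<le> n"
  shows "q_binomial (Suc n) (Suc k) = q_binomial n (Suc k) + qvar ^ (n - k) * q_binomial n k"
    and "q_binomial (Suc n) (Suc k) = qvar ^ Suc k * q_binomial n (Suc k) + q_binomial n k"
proof -
  let ?D = "q_shifted_fact qvar qvar (Suc k) * q_shifted_fact qvar qvar (n - k)"
  let ?F = "q_shifted_fact qvar qvar n"
  have nz: "?D \<noteq> 0"
    by (simp only: mult_eq_0_iff q_shifted_fact_qvar_nonzero simp_thms)
  have pow: "qvar ^ Suc n = qvar ^ (n - k) * qvar ^ Suc k"
    using assms by (simp flip: power_add power_Suc)
  have lhs: "q_binomial (Suc n) (Suc k) * ?D = ?F * (1 - qvar ^ (n - k) * qvar ^ Suc k)"
    using q_binomial_mult[of "Suc k" "Suc n"] assms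
    by (simp only: q_shifted_fact_self_Suc[of _ n] pow diff_Suc_Suc Suc_le_mono)
  note rhs = q_binomial_common_denominator[OF assms]
  have "(q_binomial n (Suc k) + qvar ^ (n - k) * q_binomial n k) * ?D
      = ?F * (1 - qvar ^ (n - k)) + qvar ^ (n - k) * (?F * (1 - qvar ^ Suc k))"
    by (simp only: distrib_right mult.assoc rhs)
  also have "\<dots> = q_binomial (Suc n) (Suc k) * ?D"
    unfolding lhs by (simp only: algebra_simps)
  finally show "q_binomial (Suc n) (Suc k)
      = q_binomial n (Suc k) + qvar ^ (n - k) * q_binomial n k"
    using nz by (metis mult_right_cancel)
  have "(qvar ^ Suc k * q_binomial n (Suc k) + q_binomial n k) * ?D
      = qvar ^ Suc k * (?F * (1 - qvar ^ (n - k))) + ?F * (1 - qvar ^ Suc k)"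
    by (simp only: distrib_right mult.assoc rhs)
  also have "\<dots> = q_binomial (Suc n) (Suc k) * ?D"
    unfolding lhs by (simp only: algebra_simps)
  finally show "q_binomial (Suc n) (Suc k)
      = qvar ^ Suc k * q_binomial n (Suc k) + q_binomial n k"
    using nz by (metis mult_right_cancel)
qed

lemma q_binomial_0 [simp]: "q_binomial n 0 = 1"
  using q_binomial_mult[of 0 n] q_shifted_fact_qvar_nonzero[of n]
  by (simp add: q_shifted_fact_0)

lemma q_binomial_self [simp]: "q_binomial n n = 1"
  using q_binomial_mult[of n n] q_shifted_fact_qvar_nonzero[of n]
  by (simp add: q_shifted_fact_0)

lemma q_binomial_eq_0: "n < k \<Longrightarrow> q_binomial n k = 0"
  by (simp add: q_binomial_def)

section \<open>The finite Jacobi triple product\<close>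

definition theta_coeff :: "int \<Rightarrow> int poly" where
  "theta_coeff k = (- 1) ^ nat \<bar>k\<bar> * qvar ^ nat (k * (k + 1) div 2)"

text \<open>The quotient of consecutive theta coefficients is \<open>- q\<^bsup>k+1\<^esup>\<close>. As \<open>k + 1\<close> may be negative, it is
  written as a difference \<open>a - b\<close> of natural numbers and \<open>q\<^sup>b\<close> is moved to the other side.\<close>

lemma theta_coeff_step:
  assumes "k + 1 = int a - int b"
  shows "qvar ^ b * theta_coeff (k + 1) = - (qvar ^ a * theta_coeff k)"
proof -
  have tri: "(k + 1) * (k + 1 + 1) div 2 = k * (k + 1) div 2 + (k + 1)"
  proof -
    have "(k + 1) * (k + 1 + 1) = k * (k + 1) + (k + 1) * 2"
      by (simp add: algebra_simps)
    then show ?thesis by simp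
  qed
  have nonneg: "0 \<le> j * (j + 1) div 2" for j :: int
    by (cases "0 \<le> j") (simp_all add: mult_nonpos_nonpos)
  have "int (b + nat ((k + 1) * (k + 1 + 1) div 2)) = int (a + nat (k * (k + 1) div 2))"
    unfolding of_nat_add int_nat_eq if_P[OF nonneg] using tri assms by linarith
  then have exponent: "b + nat ((k + 1) * (k + 1 + 1) div 2) = a + nat (k * (k + 1) div 2)"
    by (simp only: of_nat_eq_iff)
  have "nat \<bar>k + 1\<bar> = Suc (nat \<bar>k\<bar>) \<or> nat \<bar>k\<bar> = Suc (nat \<bar>k + 1\<bar>)"
    by linarith
  then have sign: "(- 1 :: int poly) ^ nat \<bar>k + 1\<bar> = - ((- 1) ^ nat \<bar>k\<bar>)"
    by (elim disjE) (simp_all only: power_Suc mult_minus_left mult_1_left minus_minus)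
  have "qvar ^ b * theta_coeff (k + 1)
      = (- 1) ^ nat \<bar>k + 1\<bar> * qvar ^ (b + nat ((k + 1) * (k + 1 + 1) div 2))"
    by (simp only: theta_coeff_def power_add mult_ac)
  also have "\<dots> = - (qvar ^ a * theta_coeff k)"
    unfolding exponent sign by (simp only: theta_coeff_def power_add mult_ac mult_minus_left)
  finally show ?thesis .
qed

text \<open>Here the polynomial variable of the outer type is \<open>z\<close>, and its coefficients are polynomials
  in \<open>q\<close>: the factors \<open>[:1, - q\<^sup>i:]\<close> and \<open>[:- q\<^sup>i, 1:]\<close> stand for \<open>1 - q\<^sup>i z\<close> and \<open>z - q\<^sup>i\<close>. The factor
  \<open>z - 1\<close> is kept apart for the differentiation.\<close>

definition triple_cofactor :: "nat \<Rightarrow> nat \<Rightarrow> int poly poly" where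
  "triple_cofactor m n = (\<Prod>i=1..m. [:1, - (qvar ^ i):]) * (\<Prod>i=1..n. [:- (qvar ^ i), 1:])"

definition triple_product :: "nat \<Rightarrow> nat \<Rightarrow> int poly poly" where
  "triple_product m n = [:- 1, 1:] * triple_cofactor m n"

lemma triple_product_Suc_left:
  "triple_product (Suc m) n = [:1, - (qvar ^ Suc m):] * triple_product m n"
  unfolding triple_product_def triple_cofactor_def
  by (simp only: prod.nat_ivl_Suc' One_nat_def Suc_le_mono le0 mult_ac)

lemma triple_product_Suc_right:
  "triple_product m (Suc n) = [:- (qvar ^ Suc n), 1:] * triple_product m n"
  unfolding triple_product_def triple_cofactor_def
  by (simp only: prod.nat_ivl_Suc' One_nat_def Suc_le_mono le0 mult_ac)

lemma coeff_linear_mult: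
  fixes a b :: "'a::comm_ring_1"
  shows "coeff ([:a, b:] * p) 0 = a * coeff p 0"
    and "coeff ([:a, b:] * p) (Suc i) = a * coeff p (Suc i) + b * coeff p i"
  by simp_all

definition triple_coeff :: "nat \<Rightarrow> nat \<Rightarrow> nat \<Rightarrow> int poly" where
  "triple_coeff m n j = theta_coeff (int j - int n - 1) * q_binomial (m + n + 1) j"

text \<open>The two recurrences in \<open>m\<close> and \<open>n\<close> are multiplication by \<open>1 - q\<^bsup>m+1\<^esup> z\<close> and by \<open>z - q\<^bsup>n+1\<^esup>\<close>,
  read off on coefficients. The first uses the \<open>q\<close>-Pascal rule that puts the power of \<open>q\<close> on the term of
  index \<open>i\<close>, the second the one that puts it on the term of index \<open>i + 1\<close>. In both, \<open>theta_coeff_step\<close> trades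
  this power, which depends on \<open>i\<close>, for one that does not.\<close>

lemma triple_coeff_Suc_left:
  "triple_coeff (Suc m) n (Suc i)
     = triple_coeff m n (Suc i) - qvar ^ Suc m * triple_coeff m n i"
proof (cases "i \<le> m + n + 1")
  case True
  let ?N = "m + n + 1"
  have step: "qvar ^ (?N - i) * theta_coeff (int i - int n)
      = - (qvar ^ Suc m * theta_coeff (int i - int n - 1))"
    using theta_coeff_step[of "int i - int n - 1" "Suc m" "?N - i"] True
    by (simp add: of_nat_diff del: power_Suc)
  have "triple_coeff (Suc m) n (Suc i) = theta_coeff (int i - int n) *
      (q_binomial ?N (Suc i) + qvar ^ (?N - i) * q_binomial ?N i)"
    using q_pascal(1)[OF True] by (simp add: triple_coeff_def)
  also have "\<dots> = theta_coeff (int i - int n) * q_binomial ?N (Suc i)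
      + (qvar ^ (?N - i) * theta_coeff (int i - int n)) * q_binomial ?N i"
    by (simp only: distrib_left mult_ac)
  also have "\<dots> = triple_coeff m n (Suc i) - qvar ^ Suc m * triple_coeff m n i"
    unfolding step by (simp add: triple_coeff_def mult.assoc del: power_Suc)
  finally show ?thesis .
next
  case False
  then show ?thesis by (simp add: triple_coeff_def q_binomial_eq_0)
qed

lemma triple_coeff_Suc_right:
  "triple_coeff m (Suc n) (Suc i)
     = triple_coeff m n i - qvar ^ Suc n * triple_coeff m n (Suc i)"
proof (cases "i \<le> m + n + 1")
  case True
  let ?N = "m + n + 1"
  have step: "qvar ^ Suc i * theta_coeff (int i - int n - 1)
      = - (qvar ^ Suc n * theta_coeff (int i - int n))"
    using theta_coeff_step[of "int i - int n - 1" "Suc i" "Suc n"]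
    by (simp del: power_Suc)
  have "triple_coeff m (Suc n) (Suc i) = theta_coeff (int i - int n - 1) *
      (qvar ^ Suc i * q_binomial ?N (Suc i) + q_binomial ?N i)"
    using q_pascal(2)[OF True] by (simp add: triple_coeff_def del: power_Suc)
  also have "\<dots> = (qvar ^ Suc i * theta_coeff (int i - int n - 1)) * q_binomial ?N (Suc i)
      + theta_coeff (int i - int n - 1) * q_binomial ?N i"
    by (simp only: distrib_left mult_ac)
  also have "\<dots> = triple_coeff m n i - qvar ^ Suc n * triple_coeff m n (Suc i)"
    unfolding step by (simp add: triple_coeff_def mult.assoc del: power_Suc)
  finally show ?thesis .
next
  case False
  then show ?thesis by (simp add: triple_coeff_def q_binomial_eq_0)
qed

lemma triple_coeff_Suc_left_0: "triple_coeff (Suc m) n 0 = triple_coeff m n 0"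
  by (simp add: triple_coeff_def)

lemma triple_coeff_Suc_right_0: "triple_coeff m (Suc n) 0 = - (qvar ^ Suc n * triple_coeff m n 0)"
proof -
  have index: "- int n - 2 + 1 = - int n - 1" "- int n - 1 = int 0 - int (Suc n)"
    by simp_all
  have "qvar ^ Suc n * theta_coeff (- int n - 1) = - theta_coeff (- int n - 2)"
    using theta_coeff_step[of "- int n - 2" 0 "Suc n", unfolded index(1), OF index(2)]
    by (simp only: power_0 mult_1_left)
  moreover have "int 0 - int (Suc n) - 1 = - int n - 2" "int 0 - int n - 1 = - int n - 1"
    by simp_all
  ultimately show ?thesis
    by (simp only: triple_coeff_def q_binomial_0 mult_1_right minus_minus)
qed

lemma coeff_triple_product: "coeff (triple_product m n) j = triple_coeff m n j"
proof (induction m arbitrary: j)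
  case 0
  show ?case
  proof (induction n arbitrary: j)
    case 0
    consider "j = 0" | "j = 1" | i where "j = Suc (Suc i)"
      by (metis One_nat_def not0_implies_Suc)
    then show ?case
      by cases (simp_all add: triple_product_def triple_cofactor_def triple_coeff_def
          theta_coeff_def q_binomial_eq_0)
  next
    case (Suc n)
    show ?case
      by (cases j) (simp_all only: triple_product_Suc_right coeff_linear_mult Suc
          triple_coeff_Suc_right triple_coeff_Suc_right_0 mult_minus_left mult_1_left
          minus_add_distrib uminus_add_conv_diff)
  qed
next
  case (Suc m)
  show ?case
    by (cases j) (simp_all only: triple_product_Suc_left coeff_linear_mult Suc
        triple_coeff_Suc_left triple_coeff_Suc_left_0 mult_minus_left mult_1_left
        add_uminus_conv_diff)
qed

lemma triple_product_expansion:
  "triple_product m n = (\<Sum>j\<le>m + n + 1. monom (triple_coeff m n j) j)"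
proof (rule poly_eqI)
  fix j
  have "triple_coeff m n j = 0" if "m + n + 1 < j"
    using that by (simp add: triple_coeff_def q_binomial_eq_0)
  then show "coeff (triple_product m n) j
      = coeff (\<Sum>j\<le>m + n + 1. monom (triple_coeff m n j) j) j"
    by (auto simp: coeff_triple_product coeff_sum not_le)
qed

section \<open>Differentiation at z = 1\<close>

lemma sum_triple_coeff: "(\<Sum>j\<le>m + n + 1. triple_coeff m n j) = 0"
proof -
  have "(\<Sum>j\<le>m + n + 1. triple_coeff m n j) = poly (triple_product m n) 1"
    by (simp add: triple_product_expansion poly_sum poly_monom)
  also have "\<dots> = 0"
    by (simp add: triple_product_def)
  finally show ?thesis .
qed

lemma weighted_sum_triple_coeff:
  "(\<Sum>j\<le>m + n + 1. of_nat j * triple_coeff m n j)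
     = q_shifted_fact qvar qvar m * q_shifted_fact qvar qvar n"
proof -
  have "pderiv (triple_product m n) = (\<Sum>j\<le>m + n + 1. pderiv (monom (triple_coeff m n j) j))"
    unfolding triple_product_expansion
    using higher_pderiv_sum[of 1 "\<lambda>j. monom (triple_coeff m n j) j" "{..m + n + 1}"]
    by (simp del: sum.atMost_Suc)
  then have "(\<Sum>j\<le>m + n + 1. of_nat j * triple_coeff m n j)
      = poly (pderiv (triple_product m n)) 1"
    by (simp add: pderiv_monom poly_sum poly_monom del: sum.atMost_Suc)
  also have "\<dots> = poly (triple_cofactor m n) 1"
    unfolding triple_product_def pderiv_mult by (simp add: pderiv_pCons)
  also have "\<dots> = q_shifted_fact qvar qvar m * q_shifted_fact qvar qvar n"
    by (simp add: triple_cofactor_def poly_prod q_shifted_fact_self)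
  finally show ?thesis .
qed

theorem theorem2p1:
  fixes m n :: nat
  shows "q_shifted_fact qvar qvar m * q_shifted_fact qvar qvar n =
    (\<Sum>k = - int n - 1..int m.
       (- 1) ^ nat \<bar>k\<bar> * of_int k * qvar ^ nat (k * (k + 1) div 2)
         * q_binomial (m + n + 1) (nat (int n + k + 1)))"
proof -
  let ?term = "\<lambda>k. (- 1) ^ nat \<bar>k\<bar> * of_int k * qvar ^ nat (k * (k + 1) div 2)
         * q_binomial (m + n + 1) (nat (int n + k + 1))"
  have shifted: "?term (int j - int n - 1)
      = of_nat j * triple_coeff m n j - of_nat (n + 1) * triple_coeff m n j" for j
  proof -
    have "?term (int j - int n - 1) = of_int (int j - int n - 1) * triple_coeff m n j"
      by (simp only: triple_coeff_def theta_coeff_def mult_ac) simp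
    then show ?thesis
      by (simp add: algebra_simps)
  qed
  have "(\<Sum>k = - int n - 1..int m. ?term k) = (\<Sum>j\<le>m + n + 1. ?term (int j - int n - 1))"
    by (rule sum.reindex_bij_witness[where i = "\<lambda>j. int j - int n - 1"
          and j = "\<lambda>k. nat (int n + k + 1)"]) auto
  also have "\<dots> = (\<Sum>j\<le>m + n + 1. of_nat j * triple_coeff m n j)
      - of_nat (n + 1) * (\<Sum>j\<le>m + n + 1. triple_coeff m n j)"
    by (simp only: shifted sum_subtractf sum_distrib_left)
  also have "\<dots> = q_shifted_fact qvar qvar m * q_shifted_fact qvar qvar n"
    by (simp only: sum_triple_coeff weighted_sum_triple_coeff mult_zero_right diff_zero)
  finally show ?thesis by (rule sym)
qed

end
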